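(* Let $G=(V,E)$ be an undirected graph and let $\mathcal{H}=\mathcal{H}_1\cup\mathcal{H}_2$ be a set of unicast sessions in $G$, with $\mathcal{H}_1,\mathcal{H}_2$ disjoint. Let $v$ be a cut-vertex in $G$ whose removal partitions the vertices into disjoint sets $V_1$ (containing the terminals of $\mathcal{H}_1$) and $V_2$ (containing the terminals of $\mathcal{H}_2$), so that no edge of $G$ joins $V_1$ to $V_2$. Then, for every edge-weight vector $\mathbf{w}\in\mathbb{R}_{\ge 0}^{|E|}$, the session sets $\mathcal{H}_1$ and $\mathcal{H}_2$ are independent under $\mathbf{w}$.
   Context: Network model. $G=(V,E)$ is a finite undirected graph. A unicast session is an ordered pair $h_i=(s_i,t_i)$ of vertices (source, sink; its terminals) with demand rate $r_i\ge 0$; $\mathcal{H}=\{h_1,\dots,h_k\}$. Each undirected edge $e=\{u,v\}$ is replaced by two opposing arcs $\vec{uv},\vec{vu}$. The sessions have mutually independent source messages $\mathcal{M}=\{M_1,\dots,M_k\}$; $M_i$ is generated at $s_i$ with rate $r_i$ and must be recovered at $t_i$. Coding. A (network) coding solution is understood in the standard sense: the transmission on each arc is a sequence of random variables (symbols), each symbol sent by a node being a function of the messages generated at that node and the symbols it has already received, such that every $t_i$ can decode $M_i$. Its flow $f$ assigns to each arc the rate of transmission on it, and $f(e)=f(\vec{uv})+f(\vec{vu})$ for $e=\{u,v\}$. A minimum-cost coding solution for $\mathcal{H}$ (under $\mathbf{w}$) is one satisfying the demands in $\mathcal{H}$ with minimum total cost $\sum_{e\in E}w(e)f(e)$ (no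 capacity constraints). Independence. Two disjoint subsets $\mathcal{H}_1,\mathcal{H}_2\subseteq\mathcal{H}$ are independent under $\mathbf{w}$ if there exists a minimum-cost coding solution for $\mathcal{H}$ such that, for every $h_i\in\mathcal{H}_1$, every $h_j\in\mathcal{H}_2$, every edge $e\in E$, and every symbol $X$ transmitted on $e$ by that solution, $$I(X;M_i\mid \mathbf{M}_{\setminus\{i\}})\cdot I(X;M_j\mid \mathbf{M}_{\setminus\{j\}})=0,$$ where $\mathbf{M}_{\setminus\{l\}}=\mathcal{M}\setminus\{M_l\}$ and $I$ denotes (conditional) mutual information.
   Formalization: The formal theorem additionally assumes that the source and sink of every session with positive demand rate are joined by a path in G; otherwise no coding solution exists, so no minimum-cost one does and independence as defined fails. *)

theory Defs
  imports "HOL-Probability.Probability"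
begin

section \<open>Undirected graphs\<close>

definition undirected_graph :: "'v set \<Rightarrow> 'v set set \<Rightarrow> bool" where
  "undirected_graph V E \<longleftrightarrow> finite V \<and> (\<forall>e\<in>E. e \<subseteq> V \<and> card e = 2)"

definition arcs :: "'v set set \<Rightarrow> ('v \<times> 'v) set" where
  "arcs E = {(u, v). {u, v} \<in> E}"

definition components :: "'v set \<Rightarrow> 'v set set \<Rightarrow> 'v set set" where
  "components V E = V // {(x, y) \<in> V \<times> V. (x, y) \<in> (arcs E)\<^sup>*}"

definition cut_vertex :: "'v set \<Rightarrow> 'v set set \<Rightarrow> 'v \<Rightarrow> bool" where
  "cut_vertex V E v \<longleftrightarrow>
     v \<in> V \<and> card (components (V - {v}) {e \<in> E. v \<notin> e}) > card (components V E)"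

section \<open>Messages\<close>

text \<open>A session is a pair (source, sink) and serves as the index of its own message. In a code of
  block length \<open>n\<close> the message of session \<open>h\<close> is uniform on \<open>\<lceil>2 powr (n * r h)\<rceil>\<close> values, i.e. it
  carries (at least) \<open>r h\<close> bits per unit of time. The sample space is the product space of the
  messages, so the messages are mutually independent; the random variable \<open>M\<^sub>h\<close> is the coordinate
  \<open>\<lambda>m. m h\<close>, and a set of messages is represented by a restriction of \<open>m\<close>.\<close>

type_synonym 'v session = "'v \<times> 'v"
type_synonym 'v messages = "'v session \<Rightarrow> nat"

definition message_space ::
  "'v session set \<Rightarrow> ('v session \<Rightarrow> real) \<Rightarrow> nat \<Rightarrow> 'v messages measure" where
  "message_space H r n =
     (\<Pi>\<^sub>M h\<in>H. uniform_count_measure {..<nat \<lceil>2 powr (real n * r h)\<rceil>})"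

definition generated :: "'v session set \<Rightarrow> 'v \<Rightarrow> 'v session set" where
  "generated H u = {h \<in> H. fst h = u}"

section \<open>Network codes\<close>

text \<open>In a code, every arc carries one symbol in each of \<open>rounds\<close> time steps; \<open>symbol C a t\<close> is the
  symbol sent on arc \<open>a\<close> at time \<open>t\<close>, a random variable on the message space (a constant symbol
  carries no information and stands for an idle arc). Rates are normalised by \<open>block_length\<close>, the
  amount of time the messages account for; \<open>rounds\<close> is not tied to it, since the symbols of one
  arc may be subdivided arbitrarily and delay is not restricted.\<close>

record 'v code =
  block_length :: nat
  rounds :: nat
  symbol :: "'v \<times> 'v \<Rightarrow> nat \<Rightarrow> 'v messages \<Rightarrow> nat"

definition received ::
  "'v set set \<Rightarrow> 'v code \<Rightarrow> 'v \<Rightarrow> nat \<Rightarrow> 'v messages \<Rightarrow> ('v \<times> 'v) \<times> nat \<Rightarrow> nat" where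
  "received E C u t m =
     restrict (\<lambda>(a, s). symbol C a s m) ({a \<in> arcs E. snd a = u} \<times> {..<t})"

definition valid_code ::
  "'v set set \<Rightarrow> 'v session set \<Rightarrow> ('v session \<Rightarrow> real) \<Rightarrow> 'v code \<Rightarrow> bool" where
  "valid_code E H r C \<longleftrightarrow>
     block_length C \<ge> 1 \<and>
     (\<forall>a\<in>arcs E. \<forall>t<rounds C. \<exists>enc. \<forall>m\<in>space (message_space H r (block_length C)).
        symbol C a t m = enc (restrict m (generated H (fst a))) (received E C (fst a) t m)) \<and>
     (\<forall>h\<in>H. \<exists>dec. \<forall>m\<in>space (message_space H r (block_length C)).
        m h = dec (restrict m (generated H (snd h))) (received E C (snd h) (rounds C) m))"

definition arc_rate ::
  "'v session set \<Rightarrow> ('v session \<Rightarrow> real) \<Rightarrow> 'v code \<Rightarrow> 'v \<times> 'v \<Rightarrow> real" where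
  "arc_rate H r C a =
     information_space.entropy_Pow (message_space H r (block_length C)) 2
       (\<lambda>m. map (\<lambda>t. symbol C a t m) [0..<rounds C]) / real (block_length C)"

section \<open>Coding solutions\<close>

text \<open>As usual for rates, a solution is a sequence of block codes, each of which meets the demands
  without error, and its flow is the limit of the rates of these codes. A single block code is
  the special case of a constant sequence.\<close>

definition coding_solution ::
  "'v set set \<Rightarrow> 'v session set \<Rightarrow> ('v session \<Rightarrow> real) \<Rightarrow> (nat \<Rightarrow> 'v code) \<Rightarrow> bool" where
  "coding_solution E H r S \<longleftrightarrow>
     (\<forall>k. valid_code E H r (S k)) \<and> (\<forall>a\<in>arcs E. convergent (\<lambda>k. arc_rate H r (S k) a))"

definition arc_flow ::
  "'v session set \<Rightarrow> ('v session \<Rightarrow> real) \<Rightarrow> (nat \<Rightarrow> 'v code) \<Rightarrow> 'v \<times> 'v \<Rightarrow> real" where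
  "arc_flow H r S a = lim (\<lambda>k. arc_rate H r (S k) a)"

definition edge_flow ::
  "'v session set \<Rightarrow> ('v session \<Rightarrow> real) \<Rightarrow> (nat \<Rightarrow> 'v code) \<Rightarrow> 'v set \<Rightarrow> real" where
  "edge_flow H r S e = (\<Sum>a\<in>{(u, v). {u, v} = e}. arc_flow H r S a)"

definition cost ::
  "'v set set \<Rightarrow> 'v session set \<Rightarrow> ('v session \<Rightarrow> real) \<Rightarrow> ('v set \<Rightarrow> real) \<Rightarrow> (nat \<Rightarrow> 'v code) \<Rightarrow> real"
  where
  "cost E H r w S = (\<Sum>e\<in>E. w e * edge_flow H r S e)"

definition min_cost_solution ::
  "'v set set \<Rightarrow> 'v session set \<Rightarrow> ('v session \<Rightarrow> real) \<Rightarrow> ('v set \<Rightarrow> real) \<Rightarrow> (nat \<Rightarrow> 'v code) \<Rightarrow> bool"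
  where
  "min_cost_solution E H r w S \<longleftrightarrow>
     coding_solution E H r S \<and> (\<forall>S'. coding_solution E H r S' \<longrightarrow> cost E H r w S \<le> cost E H r w S')"

section \<open>Independence of session sets\<close>

definition info_about ::
  "'v session set \<Rightarrow> ('v session \<Rightarrow> real) \<Rightarrow> nat \<Rightarrow> ('v messages \<Rightarrow> nat) \<Rightarrow> 'v session \<Rightarrow> real" where
  "info_about H r n X i =
     information_space.conditional_mutual_information_Pow (message_space H r n) 2
       X (\<lambda>m. m i) (\<lambda>m. restrict m (H - {i}))"

definition independent_sessions ::
  "'v set set \<Rightarrow> 'v session set \<Rightarrow> ('v session \<Rightarrow> real) \<Rightarrow> ('v set \<Rightarrow> real) \<Rightarrow>
   'v session set \<Rightarrow> 'v session set \<Rightarrow> bool" where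
  "independent_sessions E H r w H1 H2 \<longleftrightarrow>
     (\<exists>S. min_cost_solution E H r w S \<and>
        (\<forall>i\<in>H1. \<forall>j\<in>H2. \<forall>e\<in>E. \<forall>u v. {u, v} = e \<longrightarrow>
           (\<forall>k. \<forall>t<rounds (S k).
              info_about H r (block_length (S k)) (symbol (S k) (u, v) t) i *
              info_about H r (block_length (S k)) (symbol (S k) (u, v) t) j = 0)))"

end

theory Submission
  imports Defs
begin

text \<open>Freeze the messages of \<open>H2\<close> to a constant \<open>c\<close>. Then \<open>v\<close> can simulate all of \<open>V2\<close>, so the
  arcs touching \<open>V1\<close> alone still serve \<open>H1\<close>; on average over \<open>c\<close>, the entropies of the symbols on
  these arcs become conditional entropies, so some \<open>c\<close> does not increase their weighted total.
  Doing the same on the other arcs with \<open>H1\<close> frozen gives a code of no larger cost in which every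
  symbol depends on the messages of only one of \<open>H1\<close> and \<open>H2\<close>. Rates are bounded by the entropy
  of all messages, so a compactness argument turns codes with nearly minimal cost into an optimal
  solution.\<close>

subsection \<open>Uniform distributions on finite sets\<close>

lemma information_space_uniform_count_measure:
  assumes "finite \<Omega>" "\<Omega> \<noteq> {}"
  shows "information_space (uniform_count_measure \<Omega>) 2"
proof -
  interpret prob_space "uniform_count_measure \<Omega>"
    using assms by (rule prob_space_uniform_count_measure)
  show ?thesis by unfold_locales simp
qed

lemma simple_function_uniform_count_measure:
  "finite \<Omega> \<Longrightarrow> simple_function (uniform_count_measure \<Omega>) X"
  by (auto simp: simple_function_def space_uniform_count_measure sets_uniform_count_measure)

text \<open>On a finite space it suffices to compare point masses. A singleton of the product is a
  box, so its mass is the product of the numbers \<open>1 / card (A i)\<close>.\<close>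

lemma PiM_uniform_count_measure:
  assumes "finite I" and fin: "\<And>i. i \<in> I \<Longrightarrow> finite (A i)" and ne: "\<And>i. i \<in> I \<Longrightarrow> A i \<noteq> {}"
  shows "(\<Pi>\<^sub>M i\<in>I. uniform_count_measure (A i)) = uniform_count_measure (Pi\<^sub>E I A)" (is "?M = ?N")
proof (rule measure_eqI_finite)
  have fin': "finite (Pi\<^sub>E I A)"
    using assms by (intro finite_PiE) auto
  then show "finite (Pi\<^sub>E I A)" .
  \<comment> \<open>Nothing is assumed about \<open>A i\<close> outside \<open>I\<close>, while the
    product locale asks for sigma-finite factors at every index; singletons serve as harmless
    padding.\<close>
  define A' where "A' = (\<lambda>i. if i \<in> I then A i else {undefined})"
  have A': "finite (A' i)" "A' i \<noteq> {}" for i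
    using fin ne by (auto simp: A'_def)
  interpret product_sigma_finite "\<lambda>i. uniform_count_measure (A' i)"
    by (simp add: product_sigma_finite_def A' prob_space_uniform_count_measure prob_space_imp_sigma_finite)
  have M: "?M = (\<Pi>\<^sub>M i\<in>I. uniform_count_measure (A' i))"
    by (intro PiM_cong) (auto simp: A'_def)
  have sing: "{m} = (\<Pi>\<^sub>E i\<in>I. {m i})" if "m \<in> Pi\<^sub>E I A" for m
    using that by (subst PiE_singleton) (auto simp: PiE_def)
  have "{m} \<in> sets ?M" if "m \<in> Pi\<^sub>E I A" for m
    unfolding sing[OF that] using that \<open>finite I\<close>
    by (intro sets_PiM_I_finite) (auto simp: sets_uniform_count_measure PiE_iff)
  then have "X \<in> sets ?M" if "X \<subseteq> Pi\<^sub>E I A" for X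
    using that sets.finite_UN[of X "\<lambda>m. {m}" ?M] finite_subset[OF that fin'] by auto
  moreover have "sets ?M \<subseteq> Pow (Pi\<^sub>E I A)"
    using sets.space_closed[of ?M] by (simp add: space_PiM space_uniform_count_measure)
  ultimately show "sets ?M = Pow (Pi\<^sub>E I A)"
    by auto
  show "sets ?N = Pow (Pi\<^sub>E I A)"
    by (simp add: sets_uniform_count_measure)
  fix m assume m: "m \<in> Pi\<^sub>E I A"
  have "emeasure ?M {m} = (\<Prod>i\<in>I. emeasure (uniform_count_measure (A' i)) {m i})"
    unfolding M sing[OF m] using m \<open>finite I\<close>
    by (intro emeasure_PiM) (auto simp: sets_uniform_count_measure PiE_iff A'_def)
  also have "\<dots> = (\<Prod>i\<in>I. ennreal (1 / card (A i)))"
    using m by (intro prod.cong) (auto simp: emeasure_uniform_count_measure A' A'_def fin PiE_iff)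
  also have "\<dots> = ennreal (1 / card (Pi\<^sub>E I A))"
    using \<open>finite I\<close> by (simp add: prod_ennreal card_PiE prod_dividef)
  also have "\<dots> = emeasure ?N {m}"
    using m fin' by (simp add: emeasure_uniform_count_measure)
  finally show "emeasure ?M {m} = emeasure ?N {m}" .
qed

section \<open>Entropy and mutual information by counting fibres\<close>

definition fibre_prob :: "'a set \<Rightarrow> ('a \<Rightarrow> 'b) \<Rightarrow> 'b \<Rightarrow> real" where
  "fibre_prob \<Omega> X x = real (card {m\<in>\<Omega>. X m = x}) / real (card \<Omega>)"

lemma fibre_prob_nonneg: "0 \<le> fibre_prob \<Omega> X x"
  by (simp add: fibre_prob_def)

lemma fibre_prob_pos:
  assumes "finite \<Omega>" "m \<in> \<Omega>"
  shows "0 < fibre_prob \<Omega> X (X m)"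
proof -
  have "finite {m' \<in> \<Omega>. X m' = X m}" "m \<in> {m' \<in> \<Omega>. X m' = X m}"
    using assms by auto
  then have "card {m' \<in> \<Omega>. X m' = X m} \<noteq> 0" "card \<Omega> \<noteq> 0"
    using assms by (metis card_0_eq empty_iff)+
  then show ?thesis
    by (simp add: fibre_prob_def)
qed

lemma fibre_prob_le_1: "finite \<Omega> \<Longrightarrow> fibre_prob \<Omega> X x \<le> 1"
  by (simp add: fibre_prob_def card_mono divide_le_eq_1 card_gt_0_iff)

lemma simple_distributed_fibre_prob:
  assumes "finite \<Omega>" "\<Omega> \<noteq> {}"
  shows "simple_distributed (uniform_count_measure \<Omega>) X (fibre_prob \<Omega> X)"
proof -
  interpret information_space "uniform_count_measure \<Omega>" 2
    using assms by (rule information_space_uniform_count_measure)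
  show ?thesis
  proof (rule simple_distributedI)
    fix x
    have "X -` {x} \<inter> \<Omega> = {m\<in>\<Omega>. X m = x}" by auto
    then show "fibre_prob \<Omega> X x =
        measure (uniform_count_measure \<Omega>) (X -` {x} \<inter> space (uniform_count_measure \<Omega>))"
      using assms by (simp add: space_uniform_count_measure fibre_prob_def measure_uniform_count_measure)
  qed (auto simp: assms simple_function_uniform_count_measure fibre_prob_nonneg)
qed

text \<open>The range \<open>R\<close> may exceed the image of \<open>X\<close>, since missed values
  have mass 0 and contribute 0. This lets the entropies of several variables be written as sums over
  one common range.\<close>

lemma entropy_uniform_count_measure:
  assumes "finite \<Omega>" "\<Omega> \<noteq> {}" "finite R" "X ` \<Omega> \<subseteq> R"
  shows "information_space.entropy_Pow (uniform_count_measure \<Omega>) 2 X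
       = - (\<Sum>x\<in>R. fibre_prob \<Omega> X x * log 2 (fibre_prob \<Omega> X x))"
proof -
  interpret information_space "uniform_count_measure \<Omega>" 2
    using assms(1,2) by (rule information_space_uniform_count_measure)
  have "entropy_Pow X = - (\<Sum>x\<in>X ` space (uniform_count_measure \<Omega>). fibre_prob \<Omega> X x * log 2 (fibre_prob \<Omega> X x))"
    by (rule entropy_simple_distributed[OF simple_distributed_fibre_prob[OF assms(1,2)]])
  also have "\<dots> = - (\<Sum>x\<in>X ` \<Omega>. fibre_prob \<Omega> X x * log 2 (fibre_prob \<Omega> X x))"
    by (simp add: space_uniform_count_measure)
  also have "(\<Sum>x\<in>X ` \<Omega>. fibre_prob \<Omega> X x * log 2 (fibre_prob \<Omega> X x)) =
      (\<Sum>x\<in>R. fibre_prob \<Omega> X x * log 2 (fibre_prob \<Omega> X x))"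
  proof (rule sum.mono_neutral_left)
    have "fibre_prob \<Omega> X x = 0" if "x \<notin> X ` \<Omega>" for x
    proof -
      from that have "{m \<in> \<Omega>. X m = x} = {}" by auto
      show ?thesis unfolding fibre_prob_def \<open>_ = {}\<close> by simp
    qed
    then show "\<forall>x\<in>R - X ` \<Omega>. fibre_prob \<Omega> X x * log 2 (fibre_prob \<Omega> X x) = 0"
      by simp
  qed (use assms in auto)
  finally show ?thesis .
qed

lemma entropy_uniform_count_measure_nonneg:
  assumes "finite \<Omega>" "\<Omega> \<noteq> {}"
  shows "0 \<le> information_space.entropy_Pow (uniform_count_measure \<Omega>) 2 X"
proof -
  have "fibre_prob \<Omega> X (X m) * log 2 (fibre_prob \<Omega> X (X m)) \<le> 0" if "m \<in> \<Omega>" for m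
    using fibre_prob_pos[OF assms(1) that, of X] fibre_prob_le_1[OF assms(1), of X "X m"]
    by (simp add: mult_le_0_iff)
  then show ?thesis
    using assms by (subst entropy_uniform_count_measure[OF _ _ _ order_refl]) (auto intro!: sum_nonpos)
qed

lemma entropy_uniform_count_measure_le:
  assumes "finite \<Omega>" "\<Omega> \<noteq> {}"
  shows "information_space.entropy_Pow (uniform_count_measure \<Omega>) 2 X \<le> log 2 (card \<Omega>)"
proof -
  interpret information_space "uniform_count_measure \<Omega>" 2
    using assms by (rule information_space_uniform_count_measure)
  have "entropy_Pow X \<le> log 2 (card (X ` space (uniform_count_measure \<Omega>)))"
    by (rule entropy_le_card[OF simple_distributed_fibre_prob[OF assms]])
  also have "\<dots> = log 2 (card (X ` \<Omega>))"
    by (simp add: space_uniform_count_measure)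
  also have "\<dots> \<le> log 2 (card \<Omega>)"
    using assms by (simp add: card_gt_0_iff card_image_le)
  finally show ?thesis .
qed

text \<open>If \<open>Z\<close> determines \<open>X\<close>, then \<open>(X, Y, Z)\<close> has the
  fibres of \<open>(Y, Z)\<close>, and \<open>(X, Z)\<close> has those of \<open>Z\<close>. Every
  logarithm in the defining sum is then taken at 1.\<close>

lemma conditional_mutual_information_determined:
  assumes \<Omega>: "finite \<Omega>" "\<Omega> \<noteq> {}"
    and det: "\<And>m m'. m \<in> \<Omega> \<Longrightarrow> m' \<in> \<Omega> \<Longrightarrow> Z m = Z m' \<Longrightarrow> X m = X m'"
  shows "information_space.conditional_mutual_information_Pow (uniform_count_measure \<Omega>) 2 X Y Z = 0"
proof -
  interpret information_space "uniform_count_measure \<Omega>" 2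
    using \<Omega> by (rule information_space_uniform_count_measure)
  note sd = simple_distributed_fibre_prob[OF \<Omega>]
  let ?XYZ = "\<lambda>m. (X m, Y m, Z m)" and ?XZ = "\<lambda>m. (X m, Z m)" and ?YZ = "\<lambda>m. (Y m, Z m)"
  have "conditional_mutual_information_Pow X Y Z = (\<Sum>(x, y, z)\<in>?XYZ ` space (uniform_count_measure \<Omega>). fibre_prob \<Omega> ?XYZ (x, y, z) *
      log 2 (fibre_prob \<Omega> ?XYZ (x, y, z) /
        (fibre_prob \<Omega> ?XZ (x, z) * (fibre_prob \<Omega> ?YZ (y, z) / fibre_prob \<Omega> Z z))))"
    using conditional_mutual_information_eq[OF sd[of Z] sd[of ?YZ] sd[of ?XZ] sd[of ?XYZ]] .
  also have "\<dots> = 0"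
  proof (rule sum.neutral, unfold space_uniform_count_measure, clarify)
    fix m assume m: "m \<in> \<Omega>"
    have "{m'\<in>\<Omega>. ?XYZ m' = ?XYZ m} = {m'\<in>\<Omega>. ?YZ m' = ?YZ m}"
      and "{m'\<in>\<Omega>. ?XZ m' = ?XZ m} = {m'\<in>\<Omega>. Z m' = Z m}"
      using m by (auto intro: det)
    then have "fibre_prob \<Omega> ?XYZ (?XYZ m) = fibre_prob \<Omega> ?YZ (?YZ m)"
      and "fibre_prob \<Omega> ?XZ (?XZ m) = fibre_prob \<Omega> Z (Z m)"
      unfolding fibre_prob_def by (simp_all only:)
    moreover have "fibre_prob \<Omega> ?YZ (?YZ m) > 0" "fibre_prob \<Omega> Z (Z m) > 0"
      using fibre_prob_pos[OF \<Omega>(1) m] by blast+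
    ultimately show "fibre_prob \<Omega> ?XYZ (X m, Y m, Z m) * log 2 (fibre_prob \<Omega> ?XYZ (X m, Y m, Z m) /
        (fibre_prob \<Omega> ?XZ (X m, Z m) * (fibre_prob \<Omega> ?YZ (Y m, Z m) / fibre_prob \<Omega> Z (Z m)))) = 0"
      by simp
  qed
  finally show ?thesis .
qed

section \<open>Jensen's inequality for \<open>x * log 2 x\<close>, and conditioning\<close>

lemma xlogx_tangent:
  fixes p q :: real
  assumes "0 < p" "0 \<le> q"
  shows "q * log 2 p + (q - p) / ln 2 \<le> q * log 2 q"
proof (cases "q = 0")
  case False
  with assms have "q > 0" by simp
  \<comment> \<open>The tangent inequality for the logarithm at 1, multiplied by \<open>q\<close>,
    is the tangent inequality for \<open>x * log 2 x\<close> at \<open>p\<close>.\<close>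
  have "ln (p / q) \<le> p / q - 1"
    using \<open>q > 0\<close> assms by (intro ln_le_minus_one) simp
  then have "q * (ln p - ln q) \<le> q * (p / q - 1)"
    using \<open>q > 0\<close> assms by (intro mult_left_mono) (auto simp: ln_div)
  also have "\<dots> = p - q"
    using \<open>q > 0\<close> by (simp add: field_simps)
  finally have "q * ln p + (q - p) \<le> q * ln q"
    by (simp add: algebra_simps)
  then have "(q * ln p + (q - p)) / ln 2 \<le> q * ln q / ln 2"
    by (intro divide_right_mono) auto
  then show ?thesis
    by (simp add: log_def add_divide_distrib)
qed (use assms in \<open>auto simp: divide_nonpos_nonneg\<close>)

text \<open>Jensen's inequality with equal weights: the tangent bound at the mean \<open>p\<close>
  is summed over \<open>C\<close>, and the linear terms cancel. There is no tangent at
  \<open>p = 0\<close>, but a zero mean of nonnegative numbers forces all of them to vanish.\<close>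

lemma xlogx_sum_ge:
  fixes q :: "'c \<Rightarrow> real" and p :: real
  assumes C: "finite C" and q: "\<And>c. c \<in> C \<Longrightarrow> 0 \<le> q c" and p: "(\<Sum>c\<in>C. q c) = card C * p"
  shows "card C * (p * log 2 p) \<le> (\<Sum>c\<in>C. q c * log 2 (q c))"
proof (cases "C = {} \<or> p = 0")
  case True
  then have "C = {} \<or> (\<forall>c\<in>C. q c = 0)"
    using p q C by (auto simp: sum_nonneg_eq_0_iff)
  then show ?thesis using True by auto
next
  case False
  have "0 \<le> card C * p"
    unfolding p[symmetric] using q by (rule sum_nonneg)
  with False C have "p > 0"
    by (auto simp: zero_le_mult_iff)
  have "(\<Sum>c\<in>C. q c * log 2 p + (q c - p) / ln 2) \<le> (\<Sum>c\<in>C. q c * log 2 (q c))"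
    using \<open>p > 0\<close> q by (intro sum_mono xlogx_tangent)
  also have "(\<Sum>c\<in>C. q c * log 2 p + (q c - p) / ln 2) =
      (\<Sum>c\<in>C. q c) * log 2 p + ((\<Sum>c\<in>C. q c) - card C * p) / ln 2"
    by (simp add: sum.distrib sum_distrib_right sum_subtractf flip: sum_divide_distrib)
  finally show ?thesis
    by (simp add: p)
qed

text \<open>Conditioning reduces entropy: the hypothesis says that \<open>f c m\<close> is uniform on \<open>\<Omega>\<close> if \<open>c\<close> and
  \<open>m\<close> are, and \<open>X \<circ> f c\<close> is \<open>X\<close> conditioned on the value of \<open>c\<close>.\<close>

lemma sum_entropy_conditioned_le:
  assumes \<Omega>: "finite \<Omega>" "\<Omega> \<noteq> {}" and C: "finite C"
    and f: "\<And>c m. c \<in> C \<Longrightarrow> m \<in> \<Omega> \<Longrightarrow> f c m \<in> \<Omega>"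
    and unif: "\<And>P. (\<Sum>c\<in>C. card {m\<in>\<Omega>. P (f c m)}) = card C * card {m\<in>\<Omega>. P m}"
  shows "(\<Sum>c\<in>C. information_space.entropy_Pow (uniform_count_measure \<Omega>) 2 (\<lambda>m. X (f c m)))
       \<le> card C * information_space.entropy_Pow (uniform_count_measure \<Omega>) 2 X"
proof -
  let ?p = "fibre_prob \<Omega> X" and ?q = "\<lambda>c. fibre_prob \<Omega> (\<lambda>m. X (f c m))"
  have "card C * (?p x * log 2 (?p x)) \<le> (\<Sum>c\<in>C. ?q c x * log 2 (?q c x))" for x
  proof (rule xlogx_sum_ge)
    \<comment> \<open>For each value \<open>x\<close>, the hypothesis \<open>unif\<close> for the
      event \<open>X m = x\<close> says that the conditional masses average to the unconditional
      one, so Jensen applies value by value.\<close>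
    have "(\<Sum>c\<in>C. ?q c x) = real (\<Sum>c\<in>C. card {m\<in>\<Omega>. X (f c m) = x}) / card \<Omega>"
      by (simp add: fibre_prob_def sum_divide_distrib)
    also have "\<dots> = card C * ?p x"
      by (subst unif) (simp add: fibre_prob_def)
    finally show "(\<Sum>c\<in>C. ?q c x) = card C * ?p x" .
  qed (use C in \<open>auto simp: fibre_prob_nonneg\<close>)
  then have "(\<Sum>x\<in>X ` \<Omega>. card C * (?p x * log 2 (?p x))) \<le> (\<Sum>x\<in>X ` \<Omega>. \<Sum>c\<in>C. ?q c x * log 2 (?q c x))"
    by (intro sum_mono)
  also have "\<dots> = (\<Sum>c\<in>C. \<Sum>x\<in>X ` \<Omega>. ?q c x * log 2 (?q c x))"
    by (rule sum.swap)
  finally have le: "card C * (\<Sum>x\<in>X ` \<Omega>. ?p x * log 2 (?p x)) \<le>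
      (\<Sum>c\<in>C. \<Sum>x\<in>X ` \<Omega>. ?q c x * log 2 (?q c x))"
    by (simp add: sum_distrib_left)
  have "information_space.entropy_Pow (uniform_count_measure \<Omega>) 2 (\<lambda>m. X (f c m)) =
      - (\<Sum>x\<in>X ` \<Omega>. ?q c x * log 2 (?q c x))" if "c \<in> C" for c
    using \<Omega> f that by (intro entropy_uniform_count_measure) auto
  then have "(\<Sum>c\<in>C. information_space.entropy_Pow (uniform_count_measure \<Omega>) 2 (\<lambda>m. X (f c m))) =
      (\<Sum>c\<in>C. - (\<Sum>x\<in>X ` \<Omega>. ?q c x * log 2 (?q c x)))"
    by (intro sum.cong refl)
  also have "\<dots> = - (\<Sum>c\<in>C. \<Sum>x\<in>X ` \<Omega>. ?q c x * log 2 (?q c x))"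
    by (rule sum_negf)
  also have "\<dots> \<le> card C * information_space.entropy_Pow (uniform_count_measure \<Omega>) 2 X"
    unfolding entropy_uniform_count_measure[OF \<Omega> finite_imageI[OF \<Omega>(1)] order_refl] using le by linarith
  finally show ?thesis .
qed

subsection \<open>Message tuples\<close>

text \<open>The sample space of \<open>message_space\<close> as a plain finite set.\<close>

definition message_tuples :: "'v session set \<Rightarrow> ('v session \<Rightarrow> real) \<Rightarrow> nat \<Rightarrow> 'v messages set" where
  "message_tuples H r n = (\<Pi>\<^sub>E h\<in>H. {..<nat \<lceil>2 powr (real n * r h)\<rceil>})"

lemma message_count_pos: "0 < nat \<lceil>2 powr (x::real)\<rceil>"
  by simp

lemma finite_message_tuples: "finite H \<Longrightarrow> finite (message_tuples H r n)"
  by (simp add: message_tuples_def finite_PiE)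

lemma message_tuples_nonempty: "message_tuples H r n \<noteq> {}"
  unfolding message_tuples_def PiE_eq_empty_iff using message_count_pos by blast

lemma message_space_eq_uniform:
  assumes "finite H"
  shows "message_space H r n = uniform_count_measure (message_tuples H r n)"
  unfolding message_space_def message_tuples_def
  using assms message_count_pos by (intro PiM_uniform_count_measure) blast+

lemma space_message_space: "finite H \<Longrightarrow> space (message_space H r n) = message_tuples H r n"
  by (simp add: message_space_eq_uniform space_uniform_count_measure)

lemma message_tuples_undefined: "m \<in> message_tuples H r n \<Longrightarrow> h \<notin> H \<Longrightarrow> m h = undefined"
  by (auto simp: message_tuples_def)

lemma override_on_message_tuples:
  assumes "m \<in> message_tuples H r n" "c \<in> message_tuples H r n"
  shows "override_on m c A \<in> message_tuples H r n"
  using assms by (auto simp: message_tuples_def override_on_def PiE_iff extensional_def)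

lemma restrict_eq_iff: "restrict f A = restrict g A \<longleftrightarrow> (\<forall>x\<in>A. f x = g x)"
  by (auto simp: restrict_def fun_eq_iff)

text \<open>Swapping the \<open>A\<close>-coordinates of \<open>c\<close> and \<open>m\<close> is an involution on pairs of message tuples.\<close>

lemma sum_card_override_on:
  fixes H :: "'v session set" and r :: "'v session \<Rightarrow> real" and n :: nat
  assumes "finite H"
  defines "\<Omega> \<equiv> message_tuples H r n"
  shows "(\<Sum>c\<in>\<Omega>. card {m\<in>\<Omega>. P (override_on m c A)}) = card \<Omega> * card {m\<in>\<Omega>. P m}"
proof -
  have fin: "finite \<Omega>"
    using assms finite_message_tuples by simp
  let ?swap = "\<lambda>(c :: 'v messages, m :: 'v messages). (override_on c m A, override_on m c A)"
  have "(\<Sum>c\<in>\<Omega>. card {m\<in>\<Omega>. P (override_on m c A)}) = card (SIGMA c:\<Omega>. {m\<in>\<Omega>. P (override_on m c A)})"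
    using fin by (simp add: card_SigmaI)
  also have "bij_betw ?swap (SIGMA c:\<Omega>. {m\<in>\<Omega>. P (override_on m c A)}) (\<Omega> \<times> {m\<in>\<Omega>. P m})"
  proof (rule bij_betwI[where g = ?swap])
    show "?swap \<in> (SIGMA c:\<Omega>. {m\<in>\<Omega>. P (override_on m c A)}) \<rightarrow> \<Omega> \<times> {m\<in>\<Omega>. P m}"
      by (auto simp: \<Omega>_def override_on_message_tuples)
    have "override_on (override_on m c A) (override_on c m A) A = m" for c m :: "'v session \<Rightarrow> nat"
      by (auto simp: override_on_def)
    then show "?swap \<in> \<Omega> \<times> {m\<in>\<Omega>. P m} \<rightarrow> (SIGMA c:\<Omega>. {m\<in>\<Omega>. P (override_on m c A)})"
      and "?swap (?swap x) = x" "?swap (?swap y) = y" for x y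
      by (auto simp: \<Omega>_def override_on_message_tuples split: prod.split)
  qed
  then have "card (SIGMA c:\<Omega>. {m\<in>\<Omega>. P (override_on m c A)}) = card \<Omega> * card {m\<in>\<Omega>. P m}"
    by (simp add: bij_betw_same_card card_cartesian_product)
  finally show ?thesis .
qed

subsection \<open>Codes\<close>

text \<open>A function factors through a pair of maps iff it is constant on their joint fibres; the
  factor evaluates \<open>f\<close> at a chosen point of the fibre. The two maps stand for a node's
  own messages and its received symbols.\<close>

lemma ex_function_of_iff:
  "(\<exists>d. \<forall>m\<in>\<Omega>. f m = d (g m) (g' m)) \<longleftrightarrow>
   (\<forall>m\<in>\<Omega>. \<forall>m'\<in>\<Omega>. g m = g m' \<longrightarrow> g' m = g' m' \<longrightarrow> f m = f m')" (is "?L \<longleftrightarrow> ?R")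
proof
  show ?R if ?L
    using that by fastforce
next
  assume R: ?R
  define d where "d = (\<lambda>x y. f (SOME m. m \<in> \<Omega> \<and> g m = x \<and> g' m = y))"
  have "f m = d (g m) (g' m)" if "m \<in> \<Omega>" for m
  proof -
    let ?m = "SOME m'. m' \<in> \<Omega> \<and> g m' = g m \<and> g' m' = g' m"
    have "?m \<in> \<Omega> \<and> g ?m = g m \<and> g' ?m = g' m"
      by (rule someI[of _ m]) (use that in simp)
    with R that show ?thesis
      unfolding d_def by metis
  qed
  then show ?L by blast
qed

lemma received_eq_iff:
  "received E C u t m = received E C u t m' \<longleftrightarrow>
   (\<forall>b\<in>arcs E. snd b = u \<longrightarrow> (\<forall>s<t. symbol C b s m = symbol C b s m'))"
  unfolding received_def restrict_eq_iff by auto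

text \<open>The existence of encoders and decoders, rephrased without choosing them: whatever has to be
  computed at a node is constant on message tuples that the node cannot tell apart.\<close>

lemma valid_code_iff:
  fixes r :: "'v session \<Rightarrow> real"
  assumes "finite H"
  defines "\<Omega> \<equiv> \<lambda>C :: 'v code. message_tuples H r (block_length C)"
  shows "valid_code E H r C \<longleftrightarrow> block_length C \<ge> 1 \<and>
     (\<forall>a\<in>arcs E. \<forall>t<rounds C. \<forall>m\<in>\<Omega> C. \<forall>m'\<in>\<Omega> C.
        (\<forall>h\<in>generated H (fst a). m h = m' h) \<longrightarrow>
        (\<forall>b\<in>arcs E. snd b = fst a \<longrightarrow> (\<forall>s<t. symbol C b s m = symbol C b s m')) \<longrightarrow>
        symbol C a t m = symbol C a t m') \<and>
     (\<forall>h\<in>H. \<forall>m\<in>\<Omega> C. \<forall>m'\<in>\<Omega> C.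
        (\<forall>g\<in>generated H (snd h). m g = m' g) \<longrightarrow>
        (\<forall>b\<in>arcs E. snd b = snd h \<longrightarrow> (\<forall>s<rounds C. symbol C b s m = symbol C b s m')) \<longrightarrow>
        m h = m' h)"
  unfolding valid_code_def ex_function_of_iff restrict_eq_iff received_eq_iff
    space_message_space[OF assms(1)] \<Omega>_def ..

section \<open>Bounds on rates\<close>

abbreviation symbols :: "'v code \<Rightarrow> 'v \<times> 'v \<Rightarrow> 'v messages \<Rightarrow> nat list" where
  "symbols C a \<equiv> \<lambda>m. map (\<lambda>t. symbol C a t m) [0..<rounds C]"

lemma arc_rate_eq:
  assumes "finite H"
  shows "arc_rate H r C a = information_space.entropy_Pow
     (uniform_count_measure (message_tuples H r (block_length C))) 2 (symbols C a) / real (block_length C)"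
  unfolding arc_rate_def message_space_eq_uniform[OF assms] ..

lemma arc_rate_nonneg: "finite H \<Longrightarrow> 0 \<le> arc_rate H r C a"
  unfolding arc_rate_eq
  by (intro divide_nonneg_nonneg entropy_uniform_count_measure_nonneg)
    (auto simp: finite_message_tuples message_tuples_nonempty)

text \<open>An arc carries at most the entropy of all messages. The bound does not depend on the
  code, which is what the later compactness argument needs.\<close>

lemma arc_rate_le:
  assumes H: "finite H" and r: "\<forall>h\<in>H. 0 \<le> r h" and n: "block_length C \<ge> 1"
  shows "arc_rate H r C a \<le> (\<Sum>h\<in>H. r h + 1)"
proof -
  let ?n = "block_length C"
  let ?N = "\<lambda>h. nat \<lceil>2 powr (real ?n * r h)\<rceil>"
  have "log 2 (?N h) \<le> ?n * (r h + 1)" if "h \<in> H" for h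
  proof -
    \<comment> \<open>For a number that is at least 1, rounding up at most doubles it, which costs
      one bit per message.\<close>
    have "1 \<le> 2 powr (real ?n * r h)"
      using r that by (simp add: ge_one_powr_ge_zero)
    then have "?N h \<le> 2 powr (real ?n * r h) + 2 powr (real ?n * r h)"
      by linarith
    also have "\<dots> = 2 powr (real ?n * r h + 1)"
      by (simp add: powr_add)
    finally have "log 2 (?N h) \<le> real ?n * r h + 1"
      using message_count_pos[of "real ?n * r h"] by (subst log_le_iff) auto
    also have "\<dots> \<le> ?n * (r h + 1)"
      using n by (simp add: distrib_left)
    finally show ?thesis .
  qed
  then have "(\<Sum>h\<in>H. log 2 (?N h)) \<le> (\<Sum>h\<in>H. ?n * (r h + 1))"
    by (rule sum_mono)
  also have "(\<Sum>h\<in>H. log 2 (?N h)) = log 2 (\<Prod>h\<in>H. real (?N h))"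
    unfolding log_def sum_divide_distrib[symmetric]
    by (subst ln_prod) (simp_all only: H of_nat_eq_0_iff message_count_pos[THEN gr_implies_not_zero] not_False_eq_True)
  also have "(\<Prod>h\<in>H. real (?N h)) = card (message_tuples H r ?n)"
    using H by (simp add: message_tuples_def card_PiE)
  finally have "log 2 (card (message_tuples H r ?n)) \<le> (\<Sum>h\<in>H. r h + 1) * ?n"
    by (simp add: sum_distrib_left mult.commute)
  then have "information_space.entropy_Pow (uniform_count_measure (message_tuples H r ?n)) 2 (symbols C a)
      \<le> (\<Sum>h\<in>H. r h + 1) * ?n"
    using entropy_uniform_count_measure_le[OF finite_message_tuples[OF H] message_tuples_nonempty]
    by (rule order_trans[rotated])
  then show ?thesis
    using n by (simp add: arc_rate_eq[OF H] divide_le_eq)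
qed

lemma info_about_eq_0:
  assumes "finite H"
    and "\<And>m m'. m \<in> message_tuples H r n \<Longrightarrow> m' \<in> message_tuples H r n \<Longrightarrow>
      (\<forall>h\<in>H - {i}. m h = m' h) \<Longrightarrow> X m = X m'"
  shows "info_about H r n X i = 0"
  unfolding info_about_def message_space_eq_uniform[OF assms(1)]
  by (intro conditional_mutual_information_determined finite_message_tuples message_tuples_nonempty assms)
    (simp_all add: restrict_eq_iff)

text \<open>The messages in \<open>A\<close> remain in the sample space, but symbols are computed as
  if they had the values in \<open>c\<close>. Rates before and after freezing are thus entropies on
  the same space.\<close>

definition freeze :: "'v session set \<Rightarrow> 'v messages \<Rightarrow> 'v code \<Rightarrow> 'v code" where
  "freeze A c C = C\<lparr>symbol := \<lambda>a t m. symbol C a t (override_on m c A)\<rparr>"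

lemma freeze_simps [simp]:
  "block_length (freeze A c C) = block_length C"
  "rounds (freeze A c C) = rounds C"
  "symbol (freeze A c C) a t m = symbol C a t (override_on m c A)"
  by (simp_all add: freeze_def)

lemma sum_arc_rate_freeze_le:
  assumes H: "finite H"
  shows "(\<Sum>c\<in>message_tuples H r (block_length C). arc_rate H r (freeze A c C) a)
       \<le> card (message_tuples H r (block_length C)) * arc_rate H r C a"
proof -
  let ?\<Omega> = "message_tuples H r (block_length C)"
  have "(\<Sum>c\<in>?\<Omega>. information_space.entropy_Pow (uniform_count_measure ?\<Omega>) 2
          (\<lambda>m. symbols C a (override_on m c A)))
      \<le> card ?\<Omega> * information_space.entropy_Pow (uniform_count_measure ?\<Omega>) 2 (symbols C a)"
    by (intro sum_entropy_conditioned_le sum_card_override_on H finite_message_tuples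
        message_tuples_nonempty override_on_message_tuples)
  then show ?thesis
    by (simp add: arc_rate_eq[OF H] divide_right_mono flip: sum_divide_distrib)
qed

text \<open>An average cannot lie below all its terms. Averaging the weighted total, not each rate
  separately, yields a single \<open>c\<close> that serves all arcs of \<open>S\<close> at
  once.\<close>

lemma ex_freeze_not_more_expensive:
  fixes x :: "'v \<times> 'v \<Rightarrow> real"
  assumes H: "finite H" and x: "\<And>a. a \<in> S \<Longrightarrow> 0 \<le> x a"
  shows "\<exists>c\<in>message_tuples H r (block_length C).
     (\<Sum>a\<in>S. x a * arc_rate H r (freeze A c C) a) \<le> (\<Sum>a\<in>S. x a * arc_rate H r C a)"
proof (rule ccontr)
  let ?\<Omega> = "message_tuples H r (block_length C)"
  assume "\<not> ?thesis"
  then have "(\<Sum>c\<in>?\<Omega>. \<Sum>a\<in>S. x a * arc_rate H r C a) < (\<Sum>c\<in>?\<Omega>. \<Sum>a\<in>S. x a * arc_rate H r (freeze A c C) a)"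
    by (intro sum_strict_mono[of ?\<Omega>]) (simp_all add: finite_message_tuples H message_tuples_nonempty not_le)
  also have "\<dots> = (\<Sum>a\<in>S. x a * (\<Sum>c\<in>?\<Omega>. arc_rate H r (freeze A c C) a))"
    by (subst sum.swap) (simp add: sum_distrib_left)
  also have "\<dots> \<le> (\<Sum>a\<in>S. x a * (card ?\<Omega> * arc_rate H r C a))"
    by (intro sum_mono mult_left_mono sum_arc_rate_freeze_le H x)
  also have "\<dots> = (\<Sum>c\<in>?\<Omega>. \<Sum>a\<in>S. x a * arc_rate H r C a)"
    by (simp add: sum_distrib_left mult.left_commute)
  finally show False by simp
qed

subsection \<open>Networks separated by a vertex\<close>

lemma override_on_cong_at:
  "(h \<notin> A \<Longrightarrow> m h = m' h) \<Longrightarrow> override_on m c A h = override_on m' c A h"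
  by (simp add: override_on_def)

lemma mem_arcs: "a \<in> arcs E \<longleftrightarrow> {fst a, snd a} \<in> E"
  by (cases a) (simp add: arcs_def)

text \<open>The separation is expressed through arcs and symmetrically in the two sides, so that
  \<open>swap\<close> transfers every result about side 1 to side 2.\<close>

locale separated_network =
  fixes E :: "'v set set" and V1 V2 :: "'v set" and v :: 'v
    and H1 H2 :: "'v session set" and r :: "'v session \<Rightarrow> real"
  assumes finite_sessions: "finite H1" "finite H2"
    and disjoint: "V1 \<inter> V2 = {}" "v \<notin> V1" "v \<notin> V2"
    and arcs_cases: "\<And>a. a \<in> arcs E \<Longrightarrow>
      fst a \<noteq> snd a \<and> (fst a \<in> insert v V1 \<and> snd a \<in> insert v V1 \<or> fst a \<in> insert v V2 \<and> snd a \<in> insert v V2)"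
    and terminals: "H1 \<subseteq> V1 \<times> V1" "H2 \<subseteq> V2 \<times> V2"
begin

abbreviation H where "H \<equiv> H1 \<union> H2"

abbreviation \<Omega> :: "'v code \<Rightarrow> 'v messages set" where
  "\<Omega> C \<equiv> message_tuples H r (block_length C)"

lemma finite_H: "finite H"
  using finite_sessions by simp

lemma swap: "separated_network E V2 V1 v H2 H1"
  by unfold_locales (use finite_sessions disjoint terminals in \<open>auto dest: arcs_cases\<close>)

lemma valid_codeD:
  assumes "valid_code E H r C"
  shows "block_length C \<ge> 1"
    and "\<And>a t m m'. a \<in> arcs E \<Longrightarrow> t < rounds C \<Longrightarrow> m \<in> \<Omega> C \<Longrightarrow> m' \<in> \<Omega> C \<Longrightarrow>
        (\<And>h. h \<in> H \<Longrightarrow> fst h = fst a \<Longrightarrow> m h = m' h) \<Longrightarrow>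
        (\<And>b s. b \<in> arcs E \<Longrightarrow> snd b = fst a \<Longrightarrow> s < t \<Longrightarrow> symbol C b s m = symbol C b s m') \<Longrightarrow>
        symbol C a t m = symbol C a t m'"
    and "\<And>h m m'. h \<in> H \<Longrightarrow> m \<in> \<Omega> C \<Longrightarrow> m' \<in> \<Omega> C \<Longrightarrow>
        (\<And>g. g \<in> H \<Longrightarrow> fst g = snd h \<Longrightarrow> m g = m' g) \<Longrightarrow>
        (\<And>b s. b \<in> arcs E \<Longrightarrow> snd b = snd h \<Longrightarrow> s < rounds C \<Longrightarrow> symbol C b s m = symbol C b s m') \<Longrightarrow>
        m h = m' h"
  using assms unfolding valid_code_iff[OF finite_H] generated_def by blast+

text \<open>Once the messages of \<open>H2\<close> are frozen, everything outside \<open>V1\<close> can be simulated at \<open>v\<close> from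
  what \<open>v\<close> receives from \<open>V1\<close>.\<close>

lemma simulate_outside:
  assumes C: "valid_code E H r C" and m: "m \<in> \<Omega> C" "m' \<in> \<Omega> C" and eq: "\<And>h. h \<in> H2 \<Longrightarrow> m h = m' h"
    and from_V1: "\<And>b s. b \<in> arcs E \<Longrightarrow> fst b \<in> V1 \<Longrightarrow> snd b = v \<Longrightarrow> s < t \<Longrightarrow>
      symbol C b s m = symbol C b s m'"
  shows "a \<in> arcs E \<Longrightarrow> fst a \<notin> V1 \<Longrightarrow> s \<le> t \<Longrightarrow> s < rounds C \<Longrightarrow>
    symbol C a s m = symbol C a s m'"
\<comment> \<open>Induction on time: a symbol sent at time \<open>s\<close> uses only receptions
  strictly before \<open>s\<close>, so agreement of the input from \<open>V1\<close> before
  \<open>t\<close> suffices up to time \<open>t\<close> inclusive.\<close>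
proof (induction s arbitrary: a rule: less_induct)
  case (less s)
  show ?case
  proof (rule valid_codeD(2)[OF C less.prems(1,4) m])
    show "m h = m' h" if "h \<in> H" "fst h = fst a" for h
      using that less.prems terminals eq by auto
    show "symbol C b s' m = symbol C b s' m'" if b: "b \<in> arcs E" "snd b = fst a" "s' < s" for b s'
    proof (cases "fst b \<in> V1")
      case True
      \<comment> \<open>An arc leaving \<open>V1\<close> can end outside \<open>V1\<close> only in
        \<open>v\<close>.\<close>
      then have "snd b = v"
        using b less.prems arcs_cases[OF b(1)] disjoint by auto
      then show ?thesis
        using True b less.prems by (intro from_V1) auto
    next
      case False
      then show ?thesis
        using b less.prems by (intro less.IH) auto
    qed
  qed
qed

section \<open>Gluing the two frozen codes\<close>

abbreviation touches1 :: "'v \<times> 'v \<Rightarrow> bool" where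
  "touches1 a \<equiv> fst a \<in> V1 \<or> snd a \<in> V1"

text \<open>With \<open>H2\<close> frozen, the arcs of side 1 can be encoded from symbols on side 1
  alone. A node of \<open>V1\<close> hears only such arcs, and \<open>v\<close> simulates what it
  hears from the other side.\<close>

lemma freeze_encode:
  assumes C: "valid_code E H r C" and c: "c \<in> \<Omega> C" and a: "a \<in> arcs E" "touches1 a" and t: "t < rounds C"
    and m: "m \<in> \<Omega> C" "m' \<in> \<Omega> C"
    and gen: "\<And>h. h \<in> H \<Longrightarrow> fst h = fst a \<Longrightarrow> m h = m' h"
    and rec: "\<And>b s. b \<in> arcs E \<Longrightarrow> touches1 b \<Longrightarrow> snd b = fst a \<Longrightarrow> s < t \<Longrightarrow>
      symbol (freeze H2 c C) b s m = symbol (freeze H2 c C) b s m'"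
  shows "symbol (freeze H2 c C) a t m = symbol (freeze H2 c C) a t m'"
proof (cases "fst a \<in> V1")
  case True
  show ?thesis
    unfolding freeze_simps
    by (rule valid_codeD(2)[OF C a(1) t])
      (use True gen rec m c in \<open>auto simp: override_on_message_tuples intro!: override_on_cong_at\<close>)
next
  case False
  \<comment> \<open>The arc touches \<open>V1\<close> but starts outside it.\<close>
  then have v: "fst a = v"
    using a arcs_cases[OF a(1)] disjoint by auto
  show ?thesis
    unfolding freeze_simps
    by (rule simulate_outside[OF C, where t = t])
      (use False t a m c rec v in \<open>auto simp: override_on_message_tuples intro!: override_on_cong_at\<close>)
qed

lemma freeze_decode:
  assumes C: "valid_code E H r C" and c: "c \<in> \<Omega> C" and h: "h \<in> H1"
    and m: "m \<in> \<Omega> C" "m' \<in> \<Omega> C"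
    and gen: "\<And>g. g \<in> H \<Longrightarrow> fst g = snd h \<Longrightarrow> m g = m' g"
    and rec: "\<And>b s. b \<in> arcs E \<Longrightarrow> touches1 b \<Longrightarrow> snd b = snd h \<Longrightarrow> s < rounds C \<Longrightarrow>
      symbol (freeze H2 c C) b s m = symbol (freeze H2 c C) b s m'"
  shows "m h = m' h"
proof -
  have "snd h \<in> V1" "h \<notin> H2"
    using h terminals disjoint by auto
  moreover have "override_on m c H2 h = override_on m' c H2 h"
    by (rule valid_codeD(3)[OF C])
      (use calculation h gen rec m c in \<open>auto simp: override_on_message_tuples intro!: override_on_cong_at\<close>)
  ultimately show ?thesis by simp
qed

text \<open>Both frozen codes keep the timing of \<open>C\<close>, so they can run side by side on
  disjoint sets of arcs, each serving the sessions that the other one freezes.\<close>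

definition split_code :: "'v messages \<Rightarrow> 'v messages \<Rightarrow> 'v code \<Rightarrow> 'v code" where
  "split_code c c' C = C\<lparr>symbol := \<lambda>a. if touches1 a then symbol (freeze H2 c C) a else symbol (freeze H1 c' C) a\<rparr>"

lemma split_code_simps [simp]:
  "block_length (split_code c c' C) = block_length C"
  "rounds (split_code c c' C) = rounds C"
  "touches1 a \<Longrightarrow> symbol (split_code c c' C) a = symbol (freeze H2 c C) a"
  "\<not> touches1 a \<Longrightarrow> symbol (split_code c c' C) a = symbol (freeze H1 c' C) a"
  by (simp_all add: split_code_def)

lemma not_touches1_iff: "a \<in> arcs E \<Longrightarrow> \<not> touches1 a \<longleftrightarrow> fst a \<in> V2 \<or> snd a \<in> V2"
  using arcs_cases[of a] disjoint by auto

lemma arc_rate_split_code: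
  "arc_rate H r (split_code c c' C) a =
    arc_rate H r (if touches1 a then freeze H2 c C else freeze H1 c' C) a"
  by (simp add: arc_rate_def)

lemma valid_split_code:
  assumes C: "valid_code E H r C" and c: "c \<in> \<Omega> C" "c' \<in> \<Omega> C"
  shows "valid_code E H r (split_code c c' C)"
proof -
  \<comment> \<open>The same network with the sides exchanged. Its session set reads
    \<open>H2 \<union> H1\<close>, hence the rewriting by commutativity.\<close>
  interpret other: separated_network E V2 V1 v H2 H1 r
    by (rule swap)
  have C': "valid_code E (H2 \<union> H1) r C" and c'': "c' \<in> other.\<Omega> C"
    using C c by (simp_all only: Un_commute[of H2])
  let ?D = "split_code c c' C"
  show ?thesis
    unfolding valid_code_iff[OF finite_H] split_code_simps(1,2)
  proof (intro conjI ballI allI impI)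
    show "block_length C \<ge> 1"
      using C by (rule valid_codeD)
  next
    fix a :: "'v \<times> 'v" and t m m'
    assume a: "a \<in> arcs E" and t: "t < rounds C" and m: "m \<in> \<Omega> C" "m' \<in> \<Omega> C"
      and gen: "\<forall>h\<in>generated H (fst a). m h = m' h"
      and rec: "\<forall>b\<in>arcs E. snd b = fst a \<longrightarrow> (\<forall>s<t. symbol ?D b s m = symbol ?D b s m')"
    have m': "m \<in> other.\<Omega> C" "m' \<in> other.\<Omega> C"
      using m by (simp_all only: Un_commute[of H2])
    have gen: "m h = m' h" if "h \<in> H" "fst h = fst a" for h
      by (rule gen[rule_format]) (use that in \<open>simp add: generated_def\<close>)
    show "symbol ?D a t m = symbol ?D a t m'"
    proof (cases "touches1 a")
      case True
      have "symbol (freeze H2 c C) a t m = symbol (freeze H2 c C) a t m'"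
      proof (rule freeze_encode[OF C c(1) a True t m gen])
        show "symbol (freeze H2 c C) b s m = symbol (freeze H2 c C) b s m'"
          if "b \<in> arcs E" "touches1 b" "snd b = fst a" "s < t" for b s
          using rec[rule_format, OF that(1,3,4)] that(2) by simp
      qed
      with True show ?thesis by simp
    next
      case False
      then have a2: "fst a \<in> V2 \<or> snd a \<in> V2"
        using not_touches1_iff[OF a] by blast
      have "symbol (freeze H1 c' C) a t m = symbol (freeze H1 c' C) a t m'"
      proof (rule other.freeze_encode[OF C' c'' a a2 t m'])
        show "m h = m' h" if "h \<in> H2 \<union> H1" "fst h = fst a" for h
          using that by (intro gen) auto
        show "symbol (freeze H1 c' C) b s m = symbol (freeze H1 c' C) b s m'"
          if "b \<in> arcs E" "fst b \<in> V2 \<or> snd b \<in> V2" "snd b = fst a" "s < t" for b s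
          using rec[rule_format, OF that(1,3,4)] that(2) not_touches1_iff[OF that(1)] by simp
      qed
      with False show ?thesis by simp
    qed
  next
    fix h m m'
    assume h: "h \<in> H" and m: "m \<in> \<Omega> C" "m' \<in> \<Omega> C"
      and gen: "\<forall>g\<in>generated H (snd h). m g = m' g"
      and rec: "\<forall>b\<in>arcs E. snd b = snd h \<longrightarrow> (\<forall>s<rounds C. symbol ?D b s m = symbol ?D b s m')"
    have m': "m \<in> other.\<Omega> C" "m' \<in> other.\<Omega> C"
      using m by (simp_all only: Un_commute[of H2])
    have gen: "m g = m' g" if "g \<in> H" "fst g = snd h" for g
      by (rule gen[rule_format]) (use that in \<open>simp add: generated_def\<close>)
    show "m h = m' h"
    proof (cases "h \<in> H1")
      case True
      show ?thesis
      proof (rule freeze_decode[OF C c(1) True m gen])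
        show "symbol (freeze H2 c C) b s m = symbol (freeze H2 c C) b s m'"
          if "b \<in> arcs E" "touches1 b" "snd b = snd h" "s < rounds C" for b s
          using rec[rule_format, OF that(1,3,4)] that(2) by simp
      qed
    next
      case False
      with h have "h \<in> H2" by simp
      show ?thesis
      proof (rule other.freeze_decode[OF C' c'' \<open>h \<in> H2\<close> m'])
        show "m g = m' g" if "g \<in> H2 \<union> H1" "fst g = snd h" for g
          using that by (intro gen) auto
        show "symbol (freeze H1 c' C) b s m = symbol (freeze H1 c' C) b s m'"
          if "b \<in> arcs E" "fst b \<in> V2 \<or> snd b \<in> V2" "snd b = snd h" "s < rounds C" for b s
          using rec[rule_format, OF that(1,3,4)] that(2) not_touches1_iff[OF that(1)] by simp
      qed
    qed
  qed
qed

text \<open>Each arc ignores the messages of one whole side, so one of the two factors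
  vanishes.\<close>

lemma info_about_split_code:
  assumes "i \<in> H1" "j \<in> H2"
  shows "info_about H r n (symbol (split_code c c' C) a t) i *
    info_about H r n (symbol (split_code c c' C) a t) j = 0"
proof -
  have freeze: "info_about H r n (symbol (freeze A d C) a t) l = 0" if "l \<in> A" for A d l
  proof (rule info_about_eq_0[OF finite_H])
    fix m m' assume "m \<in> message_tuples H r n" "m' \<in> message_tuples H r n" "\<forall>h\<in>H - {l}. m h = m' h"
    \<comment> \<open>The tuples agree at \<open>l\<close> because \<open>l\<close> is frozen,
      elsewhere in \<open>H\<close> by assumption, and outside \<open>H\<close> because both are
      \<open>undefined\<close> there.\<close>
    then have "override_on m d A = override_on m' d A"
      using that message_tuples_undefined[of m H r n] message_tuples_undefined[of m' H r n]
      by (fastforce simp: override_on_def fun_eq_iff)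
    then show "symbol (freeze A d C) a t m = symbol (freeze A d C) a t m'"
      by simp
  qed
  then show ?thesis
    using assms by (cases "touches1 a") simp_all
qed

lemma ex_split_code:
  fixes x :: "'v \<times> 'v \<Rightarrow> real"
  assumes C: "valid_code E H r C" and fin: "finite (arcs E)" and x: "\<And>a. a \<in> arcs E \<Longrightarrow> 0 \<le> x a"
  shows "\<exists>D. valid_code E H r D \<and>
    (\<Sum>a\<in>arcs E. x a * arc_rate H r D a) \<le> (\<Sum>a\<in>arcs E. x a * arc_rate H r C a) \<and>
    (\<forall>i\<in>H1. \<forall>j\<in>H2. \<forall>n a t. info_about H r n (symbol D a t) i * info_about H r n (symbol D a t) j = 0)"
proof -
  let ?S = "{a\<in>arcs E. touches1 a}" and ?T = "{a\<in>arcs E. \<not> touches1 a}"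
  have split: "(\<Sum>a\<in>arcs E. f a) = (\<Sum>a\<in>?S. f a) + (\<Sum>a\<in>?T. f a)" for f :: "'v \<times> 'v \<Rightarrow> real"
    using fin by (subst sum.union_disjoint[symmetric]) (auto intro: sum.cong)
  obtain c where c: "c \<in> \<Omega> C"
    "(\<Sum>a\<in>?S. x a * arc_rate H r (freeze H2 c C) a) \<le> (\<Sum>a\<in>?S. x a * arc_rate H r C a)"
    using ex_freeze_not_more_expensive[OF finite_H, of ?S x] x by blast
  obtain c' where c': "c' \<in> \<Omega> C"
    "(\<Sum>a\<in>?T. x a * arc_rate H r (freeze H1 c' C) a) \<le> (\<Sum>a\<in>?T. x a * arc_rate H r C a)"
    using ex_freeze_not_more_expensive[OF finite_H, of ?T x] x by blast
  have "(\<Sum>a\<in>arcs E. x a * arc_rate H r (split_code c c' C) a) \<le> (\<Sum>a\<in>arcs E. x a * arc_rate H r C a)"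
    unfolding split using c(2) c'(2) by (simp add: arc_rate_split_code)
  then show ?thesis
    using valid_split_code[OF C c(1) c'(1)] info_about_split_code by blast
qed

end

subsection \<open>Flooding\<close>

text \<open>Every node repeats all it knows in every round, until each message of positive rate has
  reached its sink. This makes the infimum of costs range over a nonempty set.\<close>

lemma ex_valid_code:
  fixes E :: "'v set set" and H :: "'v session set"
  assumes H: "finite H" and r: "\<forall>h\<in>H. 0 \<le> r h" and feasible: "\<forall>h\<in>H. 0 < r h \<longrightarrow> h \<in> (arcs E)\<^sup>*"
  shows "\<exists>C. valid_code E H r C"
proof -
  \<comment> \<open>\<open>K t u\<close> collects the sessions whose source reaches \<open>u\<close>
    in at most \<open>t\<close> steps: what flooding has delivered to \<open>u\<close> before its
    transmission at time \<open>t\<close>.\<close>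
  define K :: "nat \<Rightarrow> 'v \<Rightarrow> 'v session set" where
    "K = (\<lambda>t u. {h\<in>H. \<exists>i\<le>t. (fst h, u) \<in> arcs E ^^ i})"
  let ?\<Omega> = "message_tuples H r 1"
  \<comment> \<open>Symbols are natural numbers, so the finitely many partial tuples are numbered
    injectively.\<close>
  have "finite ((\<lambda>(m, A). restrict m A) ` (?\<Omega> \<times> Pow H))"
    using H by (simp add: finite_message_tuples)
  from finite_imp_inj_to_nat_seg[OF this] obtain code :: "'v messages \<Rightarrow> nat" where
    inj: "inj_on code ((\<lambda>(m, A). restrict m A) ` (?\<Omega> \<times> Pow H))"
    by blast
  have KH: "K t u \<subseteq> H" for t u
    by (auto simp: K_def)
  have code_eq: "m h = m' h" if "code (restrict m A) = code (restrict m' A)"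
    "m \<in> ?\<Omega>" "m' \<in> ?\<Omega>" "A \<subseteq> H" "h \<in> A" for m m' A h
  proof -
    have "restrict m A = restrict m' A"
      using that by (intro inj_onD[OF inj]) auto
    then show ?thesis
      using that by (auto simp: restrict_eq_iff)
  qed
  have "\<exists>i. (fst h, snd h) \<in> arcs E ^^ i" if "h \<in> H" "0 < r h" for h
    using feasible that rtrancl_imp_relpow by fastforce
  then obtain d where d: "(fst h, snd h) \<in> arcs E ^^ d h" if "h \<in> H" "0 < r h" for h
    by metis
  obtain R where R: "d h \<le> R" if "h \<in> H" for h
    using finite_nat_set_iff_bounded_le[of "d ` H"] H by auto
  define C :: "'v code" where "C = \<lparr>block_length = 1, rounds = R,
    symbol = \<lambda>a t m. code (restrict m (K t (fst a)))\<rparr>"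
  have known: "m h = m' h"
    if m: "m \<in> ?\<Omega>" "m' \<in> ?\<Omega>" and gen: "\<forall>h\<in>generated H u. m h = m' h"
      and rec: "\<forall>b\<in>arcs E. snd b = u \<longrightarrow> (\<forall>s<t. symbol C b s m = symbol C b s m')" and h: "h \<in> K t u"
    for m m' u t h
  proof -
    obtain i where i: "h \<in> H" "i \<le> t" "(fst h, u) \<in> arcs E ^^ i"
      using h by (auto simp: K_def)
    show ?thesis
    proof (cases i)
      case 0
      then show ?thesis
        by (intro gen[rule_format]) (use 0 i in \<open>simp add: generated_def\<close>)
    next
      case (Suc j)
      \<comment> \<open>The last node \<open>x\<close> before \<open>u\<close> on the path sent
        \<open>K j x\<close> at time \<open>j < t\<close>, and this already contained
        \<open>h\<close>.\<close>
      then obtain x where x: "(fst h, x) \<in> arcs E ^^ j" "(x, u) \<in> arcs E"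
        using i by auto
      then have "code (restrict m (K j x)) = code (restrict m' (K j x))"
        using rec Suc i by (force simp: C_def)
      moreover have "h \<in> K j x"
        using x i by (auto simp: K_def)
      ultimately show ?thesis
        using m KH code_eq by blast
    qed
  qed
  have "valid_code E H r C"
    unfolding valid_code_iff[OF H]
  proof (intro conjI ballI allI impI)
    show "block_length C \<ge> 1"
      by (simp add: C_def)
  next
    fix a :: "'v \<times> 'v" and t m m'
    assume "m \<in> message_tuples H r (block_length C)" "m' \<in> message_tuples H r (block_length C)"
      and "\<forall>h\<in>generated H (fst a). m h = m' h"
      and "\<forall>b\<in>arcs E. snd b = fst a \<longrightarrow> (\<forall>s<t. symbol C b s m = symbol C b s m')"
    then have "restrict m (K t (fst a)) = restrict m' (K t (fst a))"
      unfolding restrict_eq_iff using known[of m m' "fst a" t] by (simp add: C_def)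
    then show "symbol C a t m = symbol C a t m'"
      by (simp add: C_def)
  next
    fix h m m'
    assume h: "h \<in> H"
      and m: "m \<in> message_tuples H r (block_length C)" "m' \<in> message_tuples H r (block_length C)"
      and gen: "\<forall>g\<in>generated H (snd h). m g = m' g"
      and rec: "\<forall>b\<in>arcs E. snd b = snd h \<longrightarrow> (\<forall>s<rounds C. symbol C b s m = symbol C b s m')"
    show "m h = m' h"
    proof (cases "0 < r h")
      case True
      then have "h \<in> K R (snd h)"
        unfolding K_def using h d R by blast
      then show ?thesis
        using known[of m m' "snd h" R h] m gen rec by (simp add: C_def)
    next
      case False
      \<comment> \<open>At rate 0 a message has exactly one possible value, so there is nothing to
        decode.\<close>
      then have "r h = 0" using r h by fastforce
      then show ?thesis
        using m[unfolded message_tuples_def, THEN PiE_mem, OF h] by simp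
    qed
  qed
  then show ?thesis ..
qed

subsection \<open>Costs\<close>

text \<open>Each arc lies over exactly one edge and inherits its weight. Cost becomes a linear
  function of arc rates, as the averaging argument requires.\<close>

lemma sum_edges_eq_sum_arcs:
  fixes w :: "'v set \<Rightarrow> real"
  assumes E: "finite E" "\<And>e. e \<in> E \<Longrightarrow> finite e"
  shows "finite (arcs E)"
    and "(\<Sum>e\<in>E. w e * (\<Sum>a\<in>{(u, v). {u, v} = e}. f a)) = (\<Sum>a\<in>arcs E. w {fst a, snd a} * f a)"
proof -
  have arcs: "arcs E = (\<Union>e\<in>E. {(u, v). {u, v} = e})"
    by (auto simp: arcs_def)
  have fin: "finite {(u, v). {u, v} = e}" if "e \<in> E" for e
    by (rule finite_subset[of _ "e \<times> e"]) (use E that in auto)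
  then show "finite (arcs E)"
    using E by (auto simp: arcs)
  show "(\<Sum>e\<in>E. w e * (\<Sum>a\<in>{(u, v). {u, v} = e}. f a)) = (\<Sum>a\<in>arcs E. w {fst a, snd a} * f a)"
    unfolding arcs using E fin
    by (subst sum.UNION_disjoint) (auto simp: sum_distrib_left intro!: sum.cong)
qed

text \<open>Bolzano-Weierstrass one coordinate at a time; passing to a further subsequence keeps the
  limits already obtained.\<close>

lemma ex_convergent_subsequence:
  fixes f :: "nat \<Rightarrow> 'a \<Rightarrow> real"
  assumes "finite A" and bounded: "\<And>a. a \<in> A \<Longrightarrow> bounded (range (\<lambda>k. f k a))"
  shows "\<exists>\<sigma> :: nat \<Rightarrow> nat. strict_mono \<sigma> \<and> (\<forall>a\<in>A. convergent (\<lambda>k. f (\<sigma> k) a))"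
  using assms
proof (induction A rule: finite_induct)
  case empty
  show ?case
    by (auto intro!: exI[of _ id] simp: strict_mono_def)
next
  case (insert x A)
  then obtain \<sigma> :: "nat \<Rightarrow> nat" where \<sigma>: "strict_mono \<sigma>" "\<forall>a\<in>A. convergent (\<lambda>k. f (\<sigma> k) a)"
    by blast
  have "bounded (range (\<lambda>k. f (\<sigma> k) x))"
    by (rule bounded_subset[OF insert.prems[of x]]) auto
  from bounded_imp_convergent_subsequence[OF this] obtain l and \<tau> :: "nat \<Rightarrow> nat"
    where \<tau>: "strict_mono \<tau>" "(\<lambda>k. f (\<sigma> (\<tau> k)) x) \<longlonglongrightarrow> l"
    by (auto simp: o_def)
  have "convergent (\<lambda>k. f ((\<sigma> \<circ> \<tau>) k) a)" if "a \<in> insert x A" for a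
    using that \<sigma>(2) \<tau> convergent_subseq_convergent[of "\<lambda>k. f (\<sigma> k) a" \<tau>]
    by (auto simp: o_def convergent_def)
  then show ?case
    using strict_mono_o[OF \<sigma>(1) \<tau>(1)] by blast
qed

lemma cost_LIMSEQ:
  fixes w :: "'v set \<Rightarrow> real"
  assumes E: "finite E" "\<And>e. e \<in> E \<Longrightarrow> finite e" and S: "coding_solution E H r S"
  shows "(\<lambda>k. \<Sum>a\<in>arcs E. w {fst a, snd a} * arc_rate H r (S k) a) \<longlonglongrightarrow> cost E H r w S"
proof -
  have "cost E H r w S = (\<Sum>a\<in>arcs E. w {fst a, snd a} * arc_flow H r S a)"
    unfolding cost_def edge_flow_def by (rule sum_edges_eq_sum_arcs(2)[OF E])
  moreover have "(\<lambda>k. arc_rate H r (S k) a) \<longlonglongrightarrow> arc_flow H r S a" if "a \<in> arcs E" for a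
    using S that by (simp add: coding_solution_def arc_flow_def convergent_LIMSEQ_iff)
  ultimately show ?thesis
    by (auto intro!: tendsto_sum tendsto_mult)
qed

text \<open>The rates are bounded, so a sequence of codes whose costs approach the infimum has a
  subsequence along which all rates converge.\<close>

lemma ex_min_cost_solution:
  fixes E :: "'v set set" and w :: "'v set \<Rightarrow> real"
  assumes E: "finite E" "\<And>e. e \<in> E \<Longrightarrow> finite e" and H: "finite H" and r: "\<forall>h\<in>H. 0 \<le> r h"
    and w: "\<forall>e\<in>E. 0 \<le> w e" and ex: "\<exists>C. valid_code E H r C"
    and improve: "\<And>C. valid_code E H r C \<Longrightarrow> \<exists>D. valid_code E H r D \<and> P D \<and>
      (\<Sum>a\<in>arcs E. w {fst a, snd a} * arc_rate H r D a) \<le> (\<Sum>a\<in>arcs E. w {fst a, snd a} * arc_rate H r C a)"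
  shows "\<exists>S. min_cost_solution E H r w S \<and> (\<forall>k. P (S k))"
proof -
  define c where "c = (\<lambda>C. \<Sum>a\<in>arcs E. w {fst a, snd a} * arc_rate H r C a)"
  \<comment> \<open>The infimum is over single block codes. It bounds the cost of every solution
    from below, because such a cost is a limit of costs of block codes.\<close>
  define \<gamma> where "\<gamma> = Inf (c ` Collect (valid_code E H r))"
  have "0 \<le> c C" for C
    unfolding c_def using w by (intro sum_nonneg mult_nonneg_nonneg arc_rate_nonneg H) (auto simp: arcs_def)
  then have bdd: "bdd_below (c ` Collect (valid_code E H r))"
    by (auto intro!: bdd_belowI[of _ 0])
  \<comment> \<open>A nearly optimal code is replaced by one with property \<open>P\<close> that
    costs no more.\<close>
  have "\<exists>D. valid_code E H r D \<and> P D \<and> c D < \<gamma> + 1 / real (Suc k)" for k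
  proof -
    have "\<gamma> < \<gamma> + 1 / real (Suc k)"
      by simp
    then obtain C where "valid_code E H r C" "c C < \<gamma> + 1 / real (Suc k)"
      unfolding \<gamma>_def using ex bdd by (subst (asm) cInf_less_iff) auto
    then show ?thesis
      using improve[of C] unfolding c_def by (meson le_less_trans)
  qed
  then obtain T where T: "valid_code E H r (T k)" "P (T k)" "c (T k) < \<gamma> + 1 / real (Suc k)" for k
    by metis
  have "block_length (T k) \<ge> 1" for k
    using T(1) by (simp add: valid_code_def)
  then have "norm (arc_rate H r (T k) a) \<le> (\<Sum>h\<in>H. r h + 1)" for k a
    using arc_rate_nonneg[OF H, of r "T k" a] arc_rate_le[OF H r, of "T k" a] by simp
  then have "bounded (range (\<lambda>k. arc_rate H r (T k) a))" for a
    unfolding bounded_iff by blast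
  then obtain \<sigma> :: "nat \<Rightarrow> nat" where \<sigma>: "strict_mono \<sigma>" "\<forall>a\<in>arcs E. convergent (\<lambda>k. arc_rate H r (T (\<sigma> k)) a)"
    using ex_convergent_subsequence[OF sum_edges_eq_sum_arcs(1)[OF E], of "\<lambda>k. arc_rate H r (T k)"] by auto
  define S where "S = T \<circ> \<sigma>"
  have S: "coding_solution E H r S"
    using T \<sigma> by (simp add: coding_solution_def S_def)
  have lim: "(\<lambda>k. c (S' k)) \<longlonglongrightarrow> cost E H r w S'" if "coding_solution E H r S'" for S'
    unfolding c_def using cost_LIMSEQ[OF E that] .
  have "(\<lambda>k. \<gamma> + 1 / real (Suc k)) \<longlonglongrightarrow> \<gamma> + 0"
    by (intro tendsto_add tendsto_const LIMSEQ_inverse_real_of_nat[unfolded inverse_eq_divide])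
  moreover have "c (S k) \<le> \<gamma> + 1 / real (Suc k)" for k
  proof -
    \<comment> \<open>A strictly increasing \<open>\<sigma>\<close> satisfies
      \<open>k \<le> \<sigma> k\<close>, so the error bound survives the passage to the
      subsequence.\<close>
    have "1 / real (Suc (\<sigma> k)) \<le> 1 / real (Suc k)"
      using seq_suble[OF \<sigma>(1), of k] by (intro divide_left_mono) auto
    then show ?thesis
      using T(3)[of "\<sigma> k"] by (simp add: S_def)
  qed
  ultimately have "cost E H r w S \<le> \<gamma>"
    using lim[OF S] LIMSEQ_le by fastforce
  moreover have "\<gamma> \<le> cost E H r w S'" if "coding_solution E H r S'" for S'
  proof (rule LIMSEQ_le_const[OF lim[OF that]])
    show "\<exists>N. \<forall>k\<ge>N. \<gamma> \<le> c (S' k)"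
      using that bdd unfolding \<gamma>_def coding_solution_def by (auto intro!: cInf_lower)
  qed
  ultimately have "min_cost_solution E H r w S"
    using S unfolding min_cost_solution_def by (meson order_trans)
  then show ?thesis
    using T(2) by (auto simp: S_def)
qed

theorem mainTheorem7:
  fixes V V1 V2 :: "'v set" and E :: "'v set set" and v :: 'v
    and H H1 H2 :: "('v \<times> 'v) set" and r :: "'v \<times> 'v \<Rightarrow> real" and w :: "'v set \<Rightarrow> real"
  assumes graph: "undirected_graph V E"
    and sessions: "H \<subseteq> V \<times> V" "H = H1 \<union> H2" "H1 \<inter> H2 = {}"
    and rates: "\<forall>h\<in>H. r h \<ge> 0"
    and feasible: "\<forall>(s, t)\<in>H. r (s, t) > 0 \<longrightarrow> (s, t) \<in> (arcs E)\<^sup>*"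
    and cut: "cut_vertex V E v"
    and partition: "V - {v} = V1 \<union> V2" "V1 \<inter> V2 = {}"
    and no_cross: "\<forall>x\<in>V1. \<forall>y\<in>V2. {x, y} \<notin> E"
    and terminals: "H1 \<subseteq> V1 \<times> V1" "H2 \<subseteq> V2 \<times> V2"
    and weights: "\<forall>e\<in>E. w e \<ge> 0"
  shows "independent_sessions E H r w H1 H2"
proof -
  have V: "finite V" and edge: "\<And>e. e \<in> E \<Longrightarrow> e \<subseteq> V \<and> card e = 2"
    using graph by (auto simp: undirected_graph_def)
  then have "finite e" if "e \<in> E" for e
    using that finite_subset by blast
  moreover have "finite E"
    using V edge by (intro finite_subset[of E "Pow V"]) auto
  ultimately have E: "finite E" "\<And>e. e \<in> E \<Longrightarrow> finite e"
    by auto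
  have H: "finite H"
    using sessions(1) V finite_subset by blast
  interpret separated_network E V1 V2 v H1 H2 r
  proof
    show "finite H1" "finite H2"
      using H sessions(2) by auto
    show "V1 \<inter> V2 = {}" "v \<notin> V1" "v \<notin> V2" "H1 \<subseteq> V1 \<times> V1" "H2 \<subseteq> V2 \<times> V2"
      using partition terminals by auto
    fix a assume "a \<in> arcs E"
    then have a: "{fst a, snd a} \<in> E" "{snd a, fst a} \<in> E"
      by (auto simp: mem_arcs insert_commute)
    have "fst a \<noteq> snd a"
      using edge[OF a(1)] by (cases "fst a = snd a") auto
    moreover have "fst a \<in> insert v (V1 \<union> V2)" "snd a \<in> insert v (V1 \<union> V2)"
      using edge[OF a(1)] partition(1) by auto
    ultimately show "fst a \<noteq> snd a \<and>
        (fst a \<in> insert v V1 \<and> snd a \<in> insert v V1 \<or> fst a \<in> insert v V2 \<and> snd a \<in> insert v V2)"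
      using no_cross a by blast
  qed
  \<comment> \<open>Independence is imposed on each code separately, so it holds for every term of
    the limiting sequence and need not be carried through a limit.\<close>
  let ?P = "\<lambda>D. \<forall>i\<in>H1. \<forall>j\<in>H2. \<forall>n a t. info_about H r n (symbol D a t) i * info_about H r n (symbol D a t) j = 0"
  have "\<exists>S. min_cost_solution E H r w S \<and> (\<forall>k. ?P (S k))"
  proof (rule ex_min_cost_solution[OF E H rates weights])
    show "\<exists>C. valid_code E H r C"
      using feasible by (intro ex_valid_code[OF H rates]) auto
    show "\<exists>D. valid_code E H r D \<and> ?P D \<and>
        (\<Sum>a\<in>arcs E. w {fst a, snd a} * arc_rate H r D a) \<le> (\<Sum>a\<in>arcs E. w {fst a, snd a} * arc_rate H r C a)"
      if "valid_code E H r C" for C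
      using ex_split_code[of C "\<lambda>a. w {fst a, snd a}"] that weights sum_edges_eq_sum_arcs(1)[OF E]
      unfolding sessions(2) mem_arcs by blast
  qed
  then show ?thesis
    unfolding independent_sessions_def by blast
qed

end
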